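(* Let $G$ be a connected triangle-free and quadrangle-free graph with $n$ vertices, $m$ edges and diameter $d$, let $M_1$ be its first Zagreb index, and let $0<\alpha<1$. Put \[ L=\alpha^{d}\bigl(n(n-1)-M_1\bigr)+\alpha^{2}(M_1-2m)+2m\alpha,\qquad U=\alpha^{3}\bigl(n(n-1)-M_1\bigr)+\alpha^{2}(M_1-2m)+2m\alpha . \] Then $L\le GC(G)\le U$, and \[ \frac{n(n-1)-M_1}{2^{d}}+\frac{M_1+2m}{4}\;\le\; C(G)\;\le\;\frac{n(n-1)+M_1+4m}{8}. \] In each formula, equality holds (in both inequalities) if the diameter $d$ is at most $3$.
   Context: All graphs are finite and simple. A graph is triangle-free and quadrangle-free if it contains no cycle of length $3$ and no cycle of length $4$. For vertices $i,j$ of a connected graph $G$, $d(i,j)$ is their distance; the diameter is $\max_{i,j}d(i,j)$. The first Zagreb index is $M_1(G)=\sum_{v\in V(G)} d_v^2$, where $d_v$ is the degree of $v$. The closeness is $C(G)=\sum_{i\in V(G)}\sum_{j\neq i}2^{-d(i,j)}$, and for fixed $0<\alpha<1$ the generalized closeness is $GC(G)=\sum_{i\in V(G)}\sum_{j\neq i}\alpha^{d(i,j)}$. *)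

theory Defs
  imports Complex_Main "Graph_Theory.Graph_Theory"
begin

text \<open>
  A finite simple graph is a \<^locale>\<open>graph\<close>: a finite symmetric digraph without loops and
  parallel arcs. Every undirected edge is represented by two opposite arcs, so that edges are
  counted as two-element sets of end points, and the degree of a vertex is its out-degree.
\<close>

definition edge_count :: "('a, 'b) pre_digraph \<Rightarrow> nat" where
  "edge_count G = card ((\<lambda>e. {tail G e, head G e}) ` arcs G)"

text \<open>
  In a symmetric digraph the walk \<open>u, v, u\<close> also satisfies \<^const>\<open>pre_digraph.cycle\<close>; for
  \<open>k \<ge> 3\<close> the directed cycles of length \<open>k\<close> are exactly the oriented undirected cycles.
\<close>

definition has_cycle_of_length :: "('a, 'b) pre_digraph \<Rightarrow> nat \<Rightarrow> bool" where
  "has_cycle_of_length G k \<longleftrightarrow> (\<exists>p. pre_digraph.cycle G p \<and> length p = k)"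

definition triangle_free :: "('a, 'b) pre_digraph \<Rightarrow> bool" where
  "triangle_free G \<longleftrightarrow> \<not> has_cycle_of_length G 3"

definition quadrangle_free :: "('a, 'b) pre_digraph \<Rightarrow> bool" where
  "quadrangle_free G \<longleftrightarrow> \<not> has_cycle_of_length G 4"

text \<open>Only meaningful if \<open>v\<close> is reachable from \<open>u\<close>.\<close>

definition graph_dist :: "('a, 'b) pre_digraph \<Rightarrow> 'a \<Rightarrow> 'a \<Rightarrow> nat" where
  "graph_dist G u v = (LEAST k. \<exists>p. pre_digraph.awalk G u p v \<and> length p = k)"

definition diameter :: "('a, 'b) pre_digraph \<Rightarrow> nat" where
  "diameter G = Max ((\<lambda>(u, v). graph_dist G u v) ` (verts G \<times> verts G))"

definition first_zagreb_index :: "('a, 'b) pre_digraph \<Rightarrow> nat" where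
  "first_zagreb_index G = (\<Sum>v\<in>verts G. (out_degree G v)\<^sup>2)"

definition closeness :: "('a, 'b) pre_digraph \<Rightarrow> real" where
  "closeness G = (\<Sum>i\<in>verts G. \<Sum>j\<in>verts G - {i}. 1 / 2 ^ graph_dist G i j)"

definition generalized_closeness :: "real \<Rightarrow> ('a, 'b) pre_digraph \<Rightarrow> real" where
  "generalized_closeness \<alpha> G = (\<Sum>i\<in>verts G. \<Sum>j\<in>verts G - {i}. \<alpha> ^ graph_dist G i j)"

end

theory Submission
  imports Defs
begin

text \<open>
  Split the \<open>n (n - 1)\<close> ordered pairs of distinct vertices by distance. The pairs at distance 1
  are the \<open>2 m\<close> arcs. Sending a path \<open>u, v, w\<close> with \<open>u \<noteq> w\<close> to \<open>(u, w)\<close> is injective, as there is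
  no quadrangle, and its image consists of the pairs at distance 2, as there is no triangle;
  counting the paths by their middle vertex, there are \<open>M\<^sub>1 - 2 m\<close> such pairs. Each of the remaining
  \<open>n (n - 1) - M\<^sub>1\<close> pairs has a distance between 3 and \<open>d\<close>, and there are none of them if
  \<open>d < 3\<close>.
\<close>

unbundle no funcset_syntax

lemma card_off_diagonal:
  assumes "finite A"
  shows "card (SIGMA a:A. A - {a}) + card A = (card A)\<^sup>2"
proof -
  have "card (SIGMA a:A. A - {a}) = card A * (card A - 1)"
    using assms by simp
  then show ?thesis
    by (cases "card A") (simp_all add: power2_eq_square)
qed

lemma card_sym_irrefl:
  assumes "finite R" and "sym R" and "irrefl R"
  shows "card R = 2 * card ((\<lambda>(u, v). {u, v}) ` R)"
proof -
  let ?ends = "\<lambda>(u, v). {u, v}"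
  have fibre: "card {x \<in> R. ?ends x = S} = 2" if "S \<in> ?ends ` R" for S
  proof -
    from that obtain u v where uv: "(u, v) \<in> R" "S = {u, v}" by auto
    with assms(2,3) have "(v, u) \<in> R" "u \<noteq> v" by (auto simp: irrefl_def dest: symD)
    with uv have "{x \<in> R. ?ends x = S} = {(u, v), (v, u)}"
      by (auto simp: doubleton_eq_iff)
    with \<open>u \<noteq> v\<close> show ?thesis by simp
  qed
  have "card R = (\<Sum>S\<in>?ends ` R. card {x \<in> R. ?ends x = S})"
    using sum.image_gen[OF assms(1), of "\<lambda>_. 1::nat" ?ends] by simp
  also have "\<dots> = (\<Sum>S\<in>?ends ` R. 2)"
    by (rule sum.cong[OF refl]) (simp add: fibre)
  finally show ?thesis by simp
qed

subsection \<open>Short cycles\<close>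

context wf_digraph
begin

lemma vwalk_imp_awalk:
  assumes "vwalk vs G"
  shows "\<exists>p. awalk (hd vs) p (last vs) \<and> awalk_verts (hd vs) p = vs"
  using assms
proof (induction rule: vwalk_induct)
  case (Base u)
  then have "awalk u [] u" by (simp add: awalk_Nil_iff)
  then show ?case by force
next
  case (Cons u v vs)
  then obtain p where "awalk v p (last (v # vs))" "awalk_verts v p = v # vs" by auto
  moreover obtain e where "e \<in> arcs G" "tail G e = u" "head G e = v"
    using Cons.hyps by (rule reachableE)
  ultimately have "awalk u (e # p) (last (v # vs))" "awalk_verts u (e # p) = u # v # vs"
    by (simp_all add: awalk_Cons_iff)
  then show ?case by (intro exI[of _ "e # p"]) simp
qed

lemma closed_vwalk_imp_has_cycle_of_length:
  assumes "vwalk vs G" "hd vs = last vs" "distinct (tl vs)" "1 < length vs"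
  shows "has_cycle_of_length G (length vs - 1)"
proof -
  obtain p where p: "awalk (hd vs) p (hd vs)" "awalk_verts (hd vs) p = vs"
    using vwalk_imp_awalk[OF assms(1)] assms(2) by auto
  then have "length p = length vs - 1"
    using length_awalk_verts[of "hd vs" p] by simp
  moreover from this p assms(3,4) have "cycle p"
    by (auto simp: cycle_def)
  ultimately show ?thesis by (auto simp: has_cycle_of_length_def)
qed

end

context loopfree_digraph
begin

lemma triangle_freeD:
  assumes "triangle_free G" "u \<rightarrow> v" "v \<rightarrow> w"
  shows "\<not> w \<rightarrow> u"
proof
  assume "w \<rightarrow> u"
  with assms(2,3) have "vwalk [u, v, w, u] G" "distinct [v, w, u]"
    by (auto simp: vwalk_def dest: adj_in_verts adj_not_same)
  from closed_vwalk_imp_has_cycle_of_length[OF this(1)] this(2) assms(1) show False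
    by (simp add: triangle_free_def numeral_3_eq_3)
qed

lemma quadrangle_freeD:
  assumes "quadrangle_free G" "u \<rightarrow> v" "v \<rightarrow> w" "w \<rightarrow> v'" "v' \<rightarrow> u"
  shows "u = w \<or> v = v'"
proof (rule ccontr)
  assume "\<not> (u = w \<or> v = v')"
  with assms(2-5) have "vwalk [u, v, w, v', u] G" "distinct [v, w, v', u]"
    by (auto simp: vwalk_def dest: adj_in_verts adj_not_same)
  from closed_vwalk_imp_has_cycle_of_length[OF this(1)] this(2) assms(1) show False
    by (simp add: quadrangle_free_def eval_nat_numeral)
qed

end

subsection \<open>Distances\<close>

context wf_digraph
begin

lemma awalk_length_iff_relpow:
  assumes "u \<in> verts G"
  shows "(\<exists>p. awalk u p v \<and> length p = k) \<longleftrightarrow> (u, v) \<in> arcs_ends G ^^ k"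
  using assms
proof (induction k arbitrary: u)
  case 0
  then show ?case by (auto simp: awalk_Nil_iff)
next
  case (Suc k)
  have "(\<exists>p. awalk u p v \<and> length p = Suc k)
      \<longleftrightarrow> (\<exists>e p. awalk u (e # p) v \<and> length p = k)"
    by (metis length_Suc_conv)
  also have "\<dots> \<longleftrightarrow> (\<exists>e\<in>arcs G. tail G e = u \<and> (\<exists>p. awalk (head G e) p v \<and> length p = k))"
    by (auto simp: awalk_Cons_iff)
  also have "\<dots> \<longleftrightarrow> (\<exists>e\<in>arcs G. tail G e = u \<and> (head G e, v) \<in> arcs_ends G ^^ k)"
    using Suc.IH by auto
  also have "\<dots> \<longleftrightarrow> (\<exists>w. u \<rightarrow> w \<and> (w, v) \<in> arcs_ends G ^^ k)"
    by (auto simp: arcs_ends_conv)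
  also have "\<dots> \<longleftrightarrow> (u, v) \<in> arcs_ends G ^^ Suc k"
    by (blast intro: relpow_Suc_I2 dest: relpow_Suc_D2)
  finally show ?case .
qed

lemma graph_dist_eq_iff_relpow:
  assumes "u \<rightarrow>\<^sup>* v"
  shows "graph_dist G u v = k \<longleftrightarrow>
    (u, v) \<in> arcs_ends G ^^ k \<and> (\<forall>j<k. (u, v) \<notin> arcs_ends G ^^ j)"
proof -
  have dist_Least: "graph_dist G u v = (LEAST k. (u, v) \<in> arcs_ends G ^^ k)"
    using assms by (simp add: graph_dist_def awalk_length_iff_relpow reachable_in_verts)
  have walk_exists: "\<exists>k. (u, v) \<in> arcs_ends G ^^ k"
    using reachable_rtranclI[OF assms] by (simp add: rtrancl_power)
  show ?thesis
  proof
    assume "graph_dist G u v = k"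
    with LeastI_ex[OF walk_exists] dist_Least show
      "(u, v) \<in> arcs_ends G ^^ k \<and> (\<forall>j<k. (u, v) \<notin> arcs_ends G ^^ j)"
      by (auto dest: not_less_Least)
  next
    assume "(u, v) \<in> arcs_ends G ^^ k \<and> (\<forall>j<k. (u, v) \<notin> arcs_ends G ^^ j)"
    then show "graph_dist G u v = k"
      unfolding dist_Least by (intro Least_equality) (auto simp: linorder_not_less[symmetric])
  qed
qed

lemma graph_dist_eq_0_iff:
  assumes "u \<rightarrow>\<^sup>* v"
  shows "graph_dist G u v = 0 \<longleftrightarrow> u = v"
  by (simp add: graph_dist_eq_iff_relpow[OF assms])

lemma graph_dist_eq_1_iff:
  assumes "u \<rightarrow>\<^sup>* v"
  shows "graph_dist G u v = 1 \<longleftrightarrow> u \<noteq> v \<and> u \<rightarrow> v"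
  by (auto simp: graph_dist_eq_iff_relpow[OF assms])

lemma graph_dist_eq_2_iff:
  assumes "u \<rightarrow>\<^sup>* w"
  shows "graph_dist G u w = 2 \<longleftrightarrow> u \<noteq> w \<and> \<not> u \<rightarrow> w \<and> (\<exists>v. u \<rightarrow> v \<and> v \<rightarrow> w)"
  by (auto simp: graph_dist_eq_iff_relpow[OF assms] numeral_2_eq_2 All_less_Suc)

end

definition pairs_at_dist :: "('a, 'b) pre_digraph \<Rightarrow> nat \<Rightarrow> ('a \<times> 'a) set" where
  "pairs_at_dist G k = {(u, v) \<in> verts G \<times> verts G. graph_dist G u v = k}"

definition pairs_at_dist_ge :: "('a, 'b) pre_digraph \<Rightarrow> nat \<Rightarrow> ('a \<times> 'a) set" where
  "pairs_at_dist_ge G k = {(u, v) \<in> verts G \<times> verts G. k \<le> graph_dist G u v}"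

lemma (in loopfree_digraph) pairs_at_dist_1:
  assumes "strongly_connected G"
  shows "pairs_at_dist G 1 = arcs_ends G"
proof -
  have "graph_dist G u v = 1 \<longleftrightarrow> u \<rightarrow> v" if "u \<in> verts G" "v \<in> verts G" for u v
    using that assms graph_dist_eq_1_iff[of u v] adj_not_same
    by (auto simp: strongly_connected_def)
  then show ?thesis by (auto simp: pairs_at_dist_def dest: adj_in_verts)
qed

lemma (in wf_digraph) pairs_at_dist_ge_1:
  assumes "strongly_connected G"
  shows "pairs_at_dist_ge G 1 = (SIGMA u:verts G. verts G - {u})"
proof -
  have "1 \<le> graph_dist G u v \<longleftrightarrow> u \<noteq> v" if "u \<in> verts G" "v \<in> verts G" for u v
    using that assms graph_dist_eq_0_iff[of u v] by (auto simp: strongly_connected_def)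
  then show ?thesis by (auto simp: pairs_at_dist_ge_def)
qed

context fin_digraph
begin

lemma finite_pairs_at_dist: "finite (pairs_at_dist G k)"
  by (rule finite_subset[of _ "verts G \<times> verts G"]) (auto simp: pairs_at_dist_def)

lemma finite_pairs_at_dist_ge: "finite (pairs_at_dist_ge G k)"
  by (rule finite_subset[of _ "verts G \<times> verts G"]) (auto simp: pairs_at_dist_ge_def)

lemma sum_pairs_at_dist_ge_Suc:
  fixes f :: "nat \<Rightarrow> 'c::semiring_1"
  shows "(\<Sum>(u, v)\<in>pairs_at_dist_ge G k. f (graph_dist G u v))
    = of_nat (card (pairs_at_dist G k)) * f k
      + (\<Sum>(u, v)\<in>pairs_at_dist_ge G (Suc k). f (graph_dist G u v))"
proof -
  have "pairs_at_dist_ge G k = pairs_at_dist G k \<union> pairs_at_dist_ge G (Suc k)"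
    and "pairs_at_dist G k \<inter> pairs_at_dist_ge G (Suc k) = {}"
    by (auto simp: pairs_at_dist_def pairs_at_dist_ge_def)
  moreover have "(\<Sum>(u, v)\<in>pairs_at_dist G k. f (graph_dist G u v))
      = (\<Sum>_\<in>pairs_at_dist G k. f k)"
    by (rule sum.cong) (auto simp: pairs_at_dist_def)
  ultimately show ?thesis
    by (simp add: sum.union_disjoint finite_pairs_at_dist finite_pairs_at_dist_ge)
qed

lemma graph_dist_le_diameter:
  assumes "u \<in> verts G" "v \<in> verts G"
  shows "graph_dist G u v \<le> diameter G"
  unfolding diameter_def by (rule Max_ge) (use assms in auto)

lemma pairs_at_dist_ge_empty:
  assumes "diameter G < k"
  shows "pairs_at_dist_ge G k = {}"
  using assms graph_dist_le_diameter by (fastforce simp: pairs_at_dist_ge_def)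

lemma sum_pairs_at_dist_ge_bounds:
  fixes f :: "nat \<Rightarrow> real"
  assumes "antimono f"
  defines "S \<equiv> \<lambda>k. \<Sum>(u, v)\<in>pairs_at_dist_ge G k. f (graph_dist G u v)"
  shows "f (diameter G) * card (pairs_at_dist_ge G k) \<le> S k"
    and "S k \<le> f k * card (pairs_at_dist_ge G k)"
proof -
  have "f (diameter G) \<le> f (graph_dist G u v)" "f (graph_dist G u v) \<le> f k"
    if "(u, v) \<in> pairs_at_dist_ge G k" for u v
    using that antimonoD[OF assms(1)] graph_dist_le_diameter
    by (auto simp: pairs_at_dist_ge_def)
  then have "(\<Sum>_\<in>pairs_at_dist_ge G k. f (diameter G)) \<le> S k"
    and "S k \<le> (\<Sum>_\<in>pairs_at_dist_ge G k. f k)"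
    unfolding S_def by (auto intro!: sum_mono simp del: sum_constant)
  then show "f (diameter G) * card (pairs_at_dist_ge G k) \<le> S k"
    and "S k \<le> f k * card (pairs_at_dist_ge G k)"
    by (simp_all add: mult.commute)
qed

end

subsection \<open>Degrees and the first Zagreb index\<close>

lemma (in fin_digraph) sum_out_degree: "(\<Sum>v\<in>verts G. out_degree G v) = card (arcs G)"
  using sum.group[of "arcs G" "verts G" "tail G" "\<lambda>_. 1::nat"]
  by (simp add: out_degree_def out_arcs_def image_subset_iff)

lemma (in nomulti_digraph) card_arcs_ends: "card (arcs_ends G) = card (arcs G)"
  unfolding arcs_ends_def by (rule card_image[OF inj_on_arc_to_ends])

lemma (in nomulti_digraph) out_degree_eq_card_successors:
  "out_degree G v = card (arcs_ends G `` {v})"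
proof -
  have "arcs_ends G `` {v} = head G ` out_arcs G v"
    by (auto simp: arcs_ends_conv)
  moreover have "inj_on (head G) (out_arcs G v)"
    by (auto intro!: inj_onI no_multi_arcs simp: arc_to_ends_def)
  ultimately show ?thesis by (simp add: out_degree_def card_image)
qed

lemma (in graph) card_arcs: "card (arcs G) = 2 * edge_count G"
proof -
  have "irrefl (arcs_ends G)" using adj_not_same by (auto simp: irrefl_def)
  moreover have "sym (arcs_ends G)" using sym_arcs by (simp add: symmetric_def)
  moreover have "finite (arcs_ends G)" by (simp add: arcs_ends_def)
  ultimately have "card (arcs_ends G) = 2 * card ((\<lambda>(u, v). {u, v}) ` arcs_ends G)"
    by (intro card_sym_irrefl)
  also have "(\<lambda>(u, v). {u, v}) ` arcs_ends G = (\<lambda>e. {tail G e, head G e}) ` arcs G"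
    by (simp add: arcs_ends_conv image_image)
  finally show ?thesis by (simp add: card_arcs_ends edge_count_def)
qed

text \<open>In a symmetric digraph, the triple \<open>(v, u, w)\<close> stands for the path \<open>u, v, w\<close>.\<close>

definition wedges :: "('a, 'b) pre_digraph \<Rightarrow> ('a \<times> 'a \<times> 'a) set" where
  "wedges G = (SIGMA v:verts G. SIGMA u:arcs_ends G `` {v}. arcs_ends G `` {v} - {u})"

lemma (in wf_digraph) mem_wedges_iff:
  "(v, u, w) \<in> wedges G \<longleftrightarrow> v \<rightarrow> u \<and> v \<rightarrow> w \<and> u \<noteq> w"
  by (auto simp: wedges_def dest: adj_in_verts)

lemma (in digraph) card_wedges: "card (wedges G) + card (arcs G) = first_zagreb_index G"
proof -
  let ?N = "\<lambda>v. arcs_ends G `` {v}"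
  have finite_N: "finite (?N v)" for v
    by (rule finite_subset[of _ "verts G"]) (auto dest: adj_in_verts)
  have "card (wedges G) = (\<Sum>v\<in>verts G. card (SIGMA u:?N v. ?N v - {u}))"
    unfolding wedges_def by (rule card_SigmaI) (auto simp: finite_N)
  then have "card (wedges G) + card (arcs G)
      = (\<Sum>v\<in>verts G. card (SIGMA u:?N v. ?N v - {u}) + card (?N v))"
    by (simp add: sum.distrib out_degree_eq_card_successors flip: sum_out_degree)
  also have "\<dots> = first_zagreb_index G"
    by (simp add: card_off_diagonal finite_N first_zagreb_index_def
        out_degree_eq_card_successors del: card_SigmaI)
  finally show ?thesis .
qed

subsection \<open>Closeness\<close>

text \<open>
  For a connected graph of girth at least five, this would be the generalized closeness if all
  pairs of vertices at distance at least 3 had distance exactly \<open>k\<close>.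
\<close>

definition closeness_estimate :: "real \<Rightarrow> nat \<Rightarrow> ('a, 'b) pre_digraph \<Rightarrow> real" where
  "closeness_estimate \<alpha> k G =
    \<alpha> ^ k * (real (card (verts G)) * (real (card (verts G)) - 1) - real (first_zagreb_index G))
    + \<alpha>\<^sup>2 * (real (first_zagreb_index G) - 2 * real (edge_count G)) + 2 * real (edge_count G) * \<alpha>"

lemma closeness_eq_generalized_closeness: "closeness G = generalized_closeness (1 / 2) G"
  by (simp add: closeness_def generalized_closeness_def power_one_over)

lemma closeness_estimate_half:
  "closeness_estimate (1 / 2) k G
    = (real (card (verts G)) * (real (card (verts G)) - 1) - real (first_zagreb_index G)) / 2 ^ k
      + (real (first_zagreb_index G) + 2 * real (edge_count G)) / 4"
  by (simp add: closeness_estimate_def field_simps)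

subsection \<open>Connected graphs of girth at least five\<close>

locale connected_girth_ge_5_graph = graph +
  assumes connected: "Digraph_Component.connected G"
    and triangle_free: "triangle_free G"
    and quadrangle_free: "quadrangle_free G"
begin

lemma strongly_connected: "strongly_connected G"
  using sym_arcs connected by (rule symmetric_connected_imp_strongly_connected)

lemma pairs_at_dist_2: "pairs_at_dist G 2 = snd ` wedges G"
proof -
  have "graph_dist G u w = 2 \<longleftrightarrow> u \<noteq> w \<and> (\<exists>v. v \<rightarrow> u \<and> v \<rightarrow> w)"
    if "u \<in> verts G" "w \<in> verts G" for u w
  proof -
    have "u \<rightarrow>\<^sup>* w" using that strongly_connected by auto
    then have "graph_dist G u w = 2 \<longleftrightarrow> u \<noteq> w \<and> \<not> u \<rightarrow> w \<and> (\<exists>v. u \<rightarrow> v \<and> v \<rightarrow> w)"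
      by (rule graph_dist_eq_2_iff)
    also have "\<dots> \<longleftrightarrow> u \<noteq> w \<and> (\<exists>v. v \<rightarrow> u \<and> v \<rightarrow> w)"
      using triangle_freeD[OF triangle_free] graph_symmetric by blast
    finally show ?thesis .
  qed
  moreover have "snd ` wedges G = {(u, w). \<exists>v. (v, u, w) \<in> wedges G}"
    by force
  ultimately show ?thesis
    by (auto simp: pairs_at_dist_def mem_wedges_iff adj_in_verts(2))
qed

lemma inj_on_snd_wedges: "inj_on snd (wedges G)"
proof (rule inj_onI)
  fix x y
  assume "x \<in> wedges G" "y \<in> wedges G" "snd x = snd y"
  then obtain v v' u w where xy: "x = (v, u, w)" "y = (v', u, w)" and "u \<noteq> w"
    and "v \<rightarrow> u" "v \<rightarrow> w" "v' \<rightarrow> u" "v' \<rightarrow> w"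
    by (cases x; cases y) (auto simp: mem_wedges_iff)
  then have "v = v'"
    using quadrangle_freeD[OF quadrangle_free, of u v w v'] graph_symmetric by blast
  with xy show "x = y" by simp
qed

lemma card_pairs_at_dist_2:
  "real (card (pairs_at_dist G 2)) = real (first_zagreb_index G) - 2 * real (edge_count G)"
proof -
  have "card (pairs_at_dist G 2) + 2 * edge_count G = first_zagreb_index G"
    using card_wedges by (simp add: pairs_at_dist_2 card_image inj_on_snd_wedges card_arcs)
  then show ?thesis by linarith
qed

lemma sum_pairs_at_dist_ge_1:
  fixes f :: "nat \<Rightarrow> real"
  shows "(\<Sum>(u, v)\<in>pairs_at_dist_ge G 1. f (graph_dist G u v))
    = 2 * real (edge_count G) * f 1
      + (real (first_zagreb_index G) - 2 * real (edge_count G)) * f 2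
      + (\<Sum>(u, v)\<in>pairs_at_dist_ge G 3. f (graph_dist G u v))"
  using sum_pairs_at_dist_ge_Suc[of f 1] sum_pairs_at_dist_ge_Suc[of f 2]
    pairs_at_dist_1[OF strongly_connected]
  by (simp add: card_arcs_ends card_arcs card_pairs_at_dist_2 del: One_nat_def)

lemma card_pairs_at_dist_ge_3:
  "real (card (pairs_at_dist_ge G 3))
    = real (card (verts G)) * (real (card (verts G)) - 1) - real (first_zagreb_index G)"
proof -
  have "card (pairs_at_dist_ge G 1) + card (verts G) = (card (verts G))\<^sup>2"
    unfolding pairs_at_dist_ge_1[OF strongly_connected] by (rule card_off_diagonal) simp
  then have "real (card (pairs_at_dist_ge G 1))
      = real (card (verts G)) * (real (card (verts G)) - 1)"
    by (simp add: algebra_simps power2_eq_square flip: of_nat_add of_nat_mult)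
  with sum_pairs_at_dist_ge_1[of "\<lambda>_. 1"] show ?thesis by simp
qed

lemma closeness_estimate_eq:
  "closeness_estimate \<alpha> k G = 2 * real (edge_count G) * \<alpha>
    + (real (first_zagreb_index G) - 2 * real (edge_count G)) * \<alpha>\<^sup>2
    + \<alpha> ^ k * card (pairs_at_dist_ge G 3)"
  by (simp add: closeness_estimate_def card_pairs_at_dist_ge_3)

lemma generalized_closeness_eq:
  "generalized_closeness \<alpha> G = 2 * real (edge_count G) * \<alpha>
    + (real (first_zagreb_index G) - 2 * real (edge_count G)) * \<alpha>\<^sup>2
    + (\<Sum>(u, v)\<in>pairs_at_dist_ge G 3. \<alpha> ^ graph_dist G u v)"
proof -
  have "generalized_closeness \<alpha> G = (\<Sum>(u, v)\<in>pairs_at_dist_ge G 1. \<alpha> ^ graph_dist G u v)"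
    by (simp add: generalized_closeness_def pairs_at_dist_ge_1[OF strongly_connected] sum.Sigma
        del: One_nat_def)
  with sum_pairs_at_dist_ge_1[of "\<lambda>k. \<alpha> ^ k"] show ?thesis by simp
qed

lemma generalized_closeness_bounds:
  assumes "0 \<le> \<alpha>" "\<alpha> \<le> 1"
  shows "closeness_estimate \<alpha> (diameter G) G \<le> generalized_closeness \<alpha> G"
    and "generalized_closeness \<alpha> G \<le> closeness_estimate \<alpha> 3 G"
proof -
  have "antimono (\<lambda>k. \<alpha> ^ k)"
    using assms by (auto intro!: antimonoI power_decreasing)
  from sum_pairs_at_dist_ge_bounds[OF this, of 3]
  show "closeness_estimate \<alpha> (diameter G) G \<le> generalized_closeness \<alpha> G"
    and "generalized_closeness \<alpha> G \<le> closeness_estimate \<alpha> 3 G"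
    by (simp_all add: closeness_estimate_eq generalized_closeness_eq)
qed

lemma closeness_estimate_diameter_le_3:
  assumes "diameter G \<le> 3"
  shows "closeness_estimate \<alpha> (diameter G) G = closeness_estimate \<alpha> 3 G"
proof (cases "diameter G = 3")
  case False
  with assms have "pairs_at_dist_ge G 3 = {}" by (intro pairs_at_dist_ge_empty) simp
  then show ?thesis by (simp add: closeness_estimate_eq)
qed simp

end

theorem theorem3p3:
  fixes G :: "('a, 'b) pre_digraph"
    and n m d M\<^sub>1 :: nat
    and \<alpha> L U :: real
  assumes "graph G"
    and "Digraph_Component.connected G"
    and "triangle_free G"
    and "quadrangle_free G"
    and "n = card (verts G)"
    and "m = edge_count G"
    and "d = diameter G"
    and "M\<^sub>1 = first_zagreb_index G"
    and "0 < \<alpha>" and "\<alpha> < 1"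
    and "L = \<alpha> ^ d * (real n * (real n - 1) - real M\<^sub>1)
             + \<alpha>\<^sup>2 * (real M\<^sub>1 - 2 * real m) + 2 * real m * \<alpha>"
    and "U = \<alpha> ^ 3 * (real n * (real n - 1) - real M\<^sub>1)
             + \<alpha>\<^sup>2 * (real M\<^sub>1 - 2 * real m) + 2 * real m * \<alpha>"
  shows "L \<le> generalized_closeness \<alpha> G \<and> generalized_closeness \<alpha> G \<le> U
    \<and> (real n * (real n - 1) - real M\<^sub>1) / 2 ^ d + (real M\<^sub>1 + 2 * real m) / 4 \<le> closeness G
    \<and> closeness G \<le> (real n * (real n - 1) + real M\<^sub>1 + 4 * real m) / 8
    \<and> (d \<le> 3 \<longrightarrow>
         generalized_closeness \<alpha> G = L \<and> generalized_closeness \<alpha> G = U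
         \<and> closeness G = (real n * (real n - 1) - real M\<^sub>1) / 2 ^ d + (real M\<^sub>1 + 2 * real m) / 4
         \<and> closeness G = (real n * (real n - 1) + real M\<^sub>1 + 4 * real m) / 8)"
proof -
  interpret connected_girth_ge_5_graph G
    using assms(1-4) by (simp add: connected_girth_ge_5_graph_def
        connected_girth_ge_5_graph_axioms_def)
  have L: "L = closeness_estimate \<alpha> d G" and U: "U = closeness_estimate \<alpha> 3 G"
    by (simp_all add: assms closeness_estimate_def)
  have lower: "(real n * (real n - 1) - real M\<^sub>1) / 2 ^ d + (real M\<^sub>1 + 2 * real m) / 4
      = closeness_estimate (1 / 2) d G"
    by (simp add: assms closeness_estimate_half)
  have upper: "(real n * (real n - 1) + real M\<^sub>1 + 4 * real m) / 8
      = closeness_estimate (1 / 2) 3 G"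
    by (simp add: assms closeness_estimate_half field_simps)
  note bounds = generalized_closeness_bounds[folded assms(7)]
    and equality = closeness_estimate_diameter_le_3[folded assms(7)]
  show ?thesis
    unfolding L U lower upper closeness_eq_generalized_closeness
    using assms(9,10) bounds[of \<alpha>] bounds[of "1 / 2"] equality[of \<alpha>] equality[of "1 / 2"]
    by auto
qed

end
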